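(* Let $G=(V,E,\mu,w)$ be a weighted forest with $n$ vertices and let $k\in\{1,\dots,n\}$. Then $$\min_{(A_1,\dots,A_k)\in\mathcal P_k(V)}\ \max_{B\in\mathcal U(A_1,\dots,A_k)}\phi(B)\;=\;\max_{(A_1,\dots,A_{n-k+1})\in\mathcal P_{n-k+1}(V)}\ \min_{B\in\mathcal U(A_1,\dots,A_{n-k+1})}\phi(B).$$
   Context: A weighted graph is a quadruple $G=(V,E,\mu,w)$ with finite vertex set $V=\{1,\dots,n\}$, edge set $E\subseteq\{\{u,v\}:u\neq v\text{ in }V\}$, vertex weight $\mu:V\to(0,\infty)$ and edge weight $w:E\to(0,\infty)$; write $\mu_v=\mu(v)$, $w_{uv}=w(\{u,v\})$. A weighted forest is a weighted graph whose underlying graph $(V,E)$ has no cycles (it need not be connected). For nonempty $A\subseteq V$, $\partial A=\{\{u,v\}\in E:u\in A,\ v\notin A\}$ and $\phi(A)=\dfrac{\sum_{\{u,v\}\in\partial A}w_{uv}}{\sum_{v\in A}\mu_v}$. $\mathcal P_m(V)$ is the set of all subpartitions of $V$ into $m$ sets, i.e. $m$-tuples $(A_1,\dots,A_m)$ of pairwise disjoint nonempty subsets of $V$ (their union need not be $V$). $\mathcal U(A_1,\dots,A_m)=\{A_{i_1}\cup\dots\cup A_{i_q}:1\le i_1<\dots<i_q\le m,\ 1\le q\le m\}$. *)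

theory Defs
  imports Complex_Main
begin

locale weighted_graph =
  fixes n :: nat
    and E :: "nat set set"
    and \<mu> :: "nat \<Rightarrow> real"
    and w :: "nat set \<Rightarrow> real"
  assumes edges: "E \<subseteq> {{u, v} | u v. u \<in> {1..n} \<and> v \<in> {1..n} \<and> u \<noteq> v}"
    and vertex_weight_pos: "v \<in> {1..n} \<Longrightarrow> \<mu> v > 0"
    and edge_weight_pos: "e \<in> E \<Longrightarrow> w e > 0"

text \<open>A cycle is given by its list of distinct vertices; at least three are required, so that
  a single edge traversed back and forth is not a cycle.\<close>

definition is_cycle :: "'a set set \<Rightarrow> 'a list \<Rightarrow> bool" where
  "is_cycle E vs \<longleftrightarrow> length vs \<ge> 3 \<and> distinct vs \<and>
     (\<forall>i < length vs. {vs ! i, vs ! (Suc i mod length vs)} \<in> E)"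

locale weighted_forest = weighted_graph +
  assumes no_cycle: "\<not> is_cycle E vs"

definition edge_boundary :: "'a set set \<Rightarrow> 'a set \<Rightarrow> 'a set set" where
  "edge_boundary E A = {{u, v} | u v. {u, v} \<in> E \<and> u \<in> A \<and> v \<notin> A}"

definition phi :: "'a set set \<Rightarrow> ('a \<Rightarrow> real) \<Rightarrow> ('a set \<Rightarrow> real) \<Rightarrow> 'a set \<Rightarrow> real" where
  "phi E \<mu> w A = (\<Sum>e \<in> edge_boundary E A. w e) / (\<Sum>v \<in> A. \<mu> v)"

text \<open>The tuple \<open>(A\<^sub>1, \<dots>, A\<^sub>m)\<close> is a list of length \<open>m\<close>, indexed from \<open>0\<close>.\<close>

definition subpartitions :: "nat \<Rightarrow> 'a set \<Rightarrow> 'a set list set" where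
  "subpartitions m V = {As. length As = m \<and>
     (\<forall>i < m. As ! i \<noteq> {} \<and> As ! i \<subseteq> V) \<and>
     (\<forall>i < m. \<forall>j < m. i \<noteq> j \<longrightarrow> As ! i \<inter> As ! j = {})}"

definition unions :: "'a set list \<Rightarrow> 'a set set" where
  "unions As = {\<Union>i\<in>I. As ! i | I. I \<noteq> {} \<and> I \<subseteq> {..<length As}}"

text \<open>\<open>Min\<close> and \<open>Max\<close> are meaningful only on finite nonempty sets; the following facts
  provide this for the sets over which they are taken.\<close>

lemma finite_subpartitions:
  assumes "finite V"
  shows "finite (subpartitions m V)"
proof (rule finite_subset)
  show "subpartitions m V \<subseteq> {As. set As \<subseteq> Pow V \<and> length As = m}"
    by (fastforce simp: subpartitions_def in_set_conv_nth)
  show "finite {As. set As \<subseteq> Pow V \<and> length As = m}"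
    using assms by (intro finite_lists_length_eq) simp
qed

lemma subpartitions_nonempty:
  assumes "m \<le> n"
  shows "subpartitions m {1..n} \<noteq> {}"
proof -
  have "map (\<lambda>i. {Suc i}) [0..<m] \<in> subpartitions m {1..n}"
    using assms by (auto simp: subpartitions_def)
  then show ?thesis by blast
qed

lemma finite_unions: "finite (unions As)"
proof -
  have "unions As = (\<lambda>I. \<Union>i\<in>I. As ! i) ` (Pow {..<length As} - {{}})"
    by (auto simp: unions_def)
  then show ?thesis by simp
qed

lemma unions_nonempty:
  assumes "length As > 0"
  shows "unions As \<noteq> {}"
  using assms by (auto simp: unions_def)

end

theory Submission
  imports Defs
begin

text \<open>
  The identity is a minimax theorem, and the two inequalities have quite different reasons.

  The maximum is at most the minimum for every weighted graph. The parts of a subpartition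
  \<open>P\<close> into \<open>k\<close> sets and of a subpartition \<open>Q\<close> into \<open>n - k + 1\<close> sets are together more numerous
  than the vertices, so their indicator functions are linearly dependent, and the
  positive (or the negative) level set of a dependency is a union of parts of both. Lemma
  \<open>common_union\<close> finds such a set \<open>S\<close> without linear algebra. Then \<open>\<phi>(S)\<close> lies above the minimum
  over the unions of \<open>Q\<close> and below the maximum over the unions of \<open>P\<close>.

  The converse uses that the graph is a forest. For a real \<open>\<lambda>\<close> let the energy of \<open>S\<close> be the weight
  of the boundary of \<open>S\<close> minus \<open>\<lambda>\<close> times the vertex weight of \<open>S\<close>; its sign tells whether
  \<open>\<phi>(S) < \<lambda>\<close> or \<open>\<phi>(S) \<ge> \<lambda>\<close>. Lemma \<open>forest_has_inertia_split\<close>, a combinatorial form of Sylvester's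
  law of inertia, gives subpartitions \<open>P\<close> and \<open>Q\<close> with exactly \<open>n\<close> parts altogether such that
  the energy is negative on all unions of \<open>P\<close> and nonnegative on all unions of \<open>Q\<close>. If \<open>\<lambda>\<close> is the
  minimum over subpartitions into \<open>k\<close> sets, then \<open>P\<close> has fewer than \<open>k\<close> parts, so \<open>Q\<close> has at
  least \<open>n - k + 1\<close>, and any \<open>n - k + 1\<close> of them show that the maximum is at least \<open>\<lambda>\<close>.

  The inertia split is built by removing a leaf \<open>u\<close> attached to \<open>p\<close>. For this the vertex
  weight in the energy has to be an arbitrary real function, because the weight
  at \<open>p\<close> must absorb the effect of \<open>u\<close>, and it may change sign. The leaf either becomes a new
  part of \<open>P\<close>, or a new part of \<open>Q\<close>, or both a new part of \<open>Q\<close> and an addition to the part of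
  \<open>P\<close> that contains \<open>p\<close> (lemma \<open>inertia_split_leaf\<close>).
\<close>

section \<open>Subpartitions as sets of parts\<close>

text \<open>Subpartitions are handled as sets of parts, so that adding and enlarging parts are set
  operations; the tuples of the theorem are translated at the end of this section.\<close>

definition subpart :: "'a set \<Rightarrow> 'a set set \<Rightarrow> bool" where
  "subpart V P \<longleftrightarrow> P \<subseteq> Pow V - {{}} \<and> pairwise disjnt P"

definition part_unions :: "'a set set \<Rightarrow> 'a set set" where
  "part_unions P = {\<Union>C | C. C \<subseteq> P \<and> C \<noteq> {}}"

lemma subpart_finite: "finite V \<Longrightarrow> subpart V P \<Longrightarrow> finite P"
  unfolding subpart_def by (rule finite_subset[of _ "Pow V"]) auto

lemma part_unions_subset: "subpart V P \<Longrightarrow> S \<in> part_unions P \<Longrightarrow> S \<subseteq> V"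
  unfolding subpart_def part_unions_def by blast

lemma part_unions_not_empty: "subpart V P \<Longrightarrow> S \<in> part_unions P \<Longrightarrow> S \<noteq> {}"
  unfolding subpart_def part_unions_def by blast

lemma part_unions_mono: "P \<subseteq> Q \<Longrightarrow> part_unions P \<subseteq> part_unions Q"
  unfolding part_unions_def by blast

lemma subpart_unique:
  assumes "subpart V P" "X \<in> P" "Y \<in> P" "v \<in> X" "v \<in> Y"
  shows "X = Y"
  using assms unfolding subpart_def pairwise_def disjnt_def by blast

lemma subpart_mono: "subpart V P \<Longrightarrow> V \<subseteq> W \<Longrightarrow> subpart W P"
  unfolding subpart_def by blast

lemma subpart_insert_singleton:
  assumes "subpart V P" "u \<notin> V"
  shows "subpart (insert u V) (insert {u} P)" "{u} \<notin> P"
proof -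
  have "u \<notin> X" if "X \<in> P" for X using that assms unfolding subpart_def by blast
  then show "{u} \<notin> P" "subpart (insert u V) (insert {u} P)"
    using assms(1) by (auto simp: subpart_def pairwise_insert disjnt_def)
qed

lemma part_unions_insert_singletonE:
  assumes "S \<in> part_unions (insert {u} P)"
  obtains "S \<in> part_unions P"
    | S' where "S = insert u S'" "S' = {} \<or> S' \<in> part_unions P"
proof -
  obtain C where C: "S = \<Union>C" "C \<subseteq> insert {u} P" "C \<noteq> {}"
    using assms unfolding part_unions_def by blast
  show thesis
  proof (cases "{u} \<in> C")
    case True
    have "S = insert u (\<Union>(C - {{u}}))" using C True by auto
    moreover have "\<Union>(C - {{u}}) = {} \<or> \<Union>(C - {{u}}) \<in> part_unions P"
      using C unfolding part_unions_def by blast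
    ultimately show thesis using that(2) by blast
  next
    case False
    then show thesis using that(1) C unfolding part_unions_def by blast
  qed
qed

text \<open>Attaching a new vertex \<open>u\<close> to the part containing \<open>p\<close> commutes with taking unions: the
  unions of the new parts arise from the unions of the old ones by the same operation.\<close>

lemma subpart_attach:
  fixes u p :: 'a and V :: "'a set"
  defines "h \<equiv> \<lambda>X. if p \<in> X then insert u X else X"
  assumes P: "subpart V P" and u: "u \<notin> V"
  shows "subpart (insert u V) (h ` P)" "card (h ` P) = card P"
    "S \<in> part_unions (h ` P) \<Longrightarrow> \<exists>T \<in> part_unions P. S = h T"
proof -
  have notin: "u \<notin> X" if "X \<in> P" for X
    using that P u unfolding subpart_def by blast
  have "inj_on h P"
  proof (rule inj_onI)
    fix X Y assume "X \<in> P" "Y \<in> P" "h X = h Y"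
    moreover have "h Z - {u} = Z" if "Z \<in> P" for Z
      using notin[OF that] by (auto simp: h_def)
    ultimately show "X = Y" by metis
  qed
  then show "card (h ` P) = card P" by (rule card_image)
  have "disjnt (h X) (h Y)" if "X \<in> P" "Y \<in> P" "X \<noteq> Y" for X Y
  proof -
    have "X \<inter> Y = {}"
      using that P unfolding subpart_def pairwise_def disjnt_def by blast
    then show ?thesis
      using notin that by (auto simp: h_def disjnt_def)
  qed
  then have "pairwise disjnt (h ` P)"
    unfolding pairwise_image by (simp add: pairwise_def)
  then show "subpart (insert u V) (h ` P)"
    using P unfolding subpart_def by (auto simp: h_def split: if_splits)
  show "\<exists>T \<in> part_unions P. S = h T" if S: "S \<in> part_unions (h ` P)"
  proof -
    obtain C where C: "S = \<Union>C" "C \<subseteq> h ` P" "C \<noteq> {}"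
      using S unfolding part_unions_def by blast
    then obtain D where D: "D \<subseteq> P" "C = h ` D"
      by (meson subset_image_iff)
    have "\<Union>(h ` D) = h (\<Union>D)" by (auto simp: h_def)
    moreover have "\<Union>D \<in> part_unions P" using C D unfolding part_unions_def by blast
    ultimately show ?thesis using C D by blast
  qed
qed

lemma subpartitions_imp_subpart:
  assumes "As \<in> subpartitions m V"
  shows "subpart V (set As)" "card (set As) = m"
proof -
  have len: "length As = m"
    and ne: "\<And>i. i < m \<Longrightarrow> As ! i \<noteq> {} \<and> As ! i \<subseteq> V"
    and dis: "\<And>i j. i < m \<Longrightarrow> j < m \<Longrightarrow> i \<noteq> j \<Longrightarrow> As ! i \<inter> As ! j = {}"
    using assms unfolding subpartitions_def by auto
  have "distinct As"
    unfolding distinct_conv_nth using len ne dis by (metis inf.idem)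
  then show "card (set As) = m" using len distinct_card by blast
  have "disjnt X Y" if XY: "X \<in> set As" "Y \<in> set As" "X \<noteq> Y" for X Y
  proof -
    obtain i j where "i < m" "j < m" "X = As ! i" "Y = As ! j"
      using XY(1,2) len by (auto simp: in_set_conv_nth)
    then show ?thesis using XY(3) dis[of i j] unfolding disjnt_def by blast
  qed
  then have "pairwise disjnt (set As)" by (rule pairwiseI)
  moreover have "X \<noteq> {} \<and> X \<subseteq> V" if "X \<in> set As" for X
    using that ne len unfolding in_set_conv_nth by blast
  ultimately show "subpart V (set As)" unfolding subpart_def by blast
qed

lemma subpart_imp_subpartitions:
  assumes P: "subpart V P" and m: "m \<le> card P"
  obtains As where "As \<in> subpartitions m V" "set As \<subseteq> P"
proof -
  obtain Q where Q: "Q \<subseteq> P" "card Q = m" "finite Q"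
    using m by (meson obtain_subset_with_card_n)
  obtain As where As: "set As = Q" "distinct As"
    using Q(3) finite_distinct_list by blast
  have len: "length As = m" using As Q distinct_card by fastforce
  have mem: "As ! i \<in> P" if "i < m" for i
    using that len As Q by (metis nth_mem subsetD)
  have "As ! i \<inter> As ! j = {}" if "i < m" "j < m" "i \<noteq> j" for i j
  proof -
    have "As ! i \<noteq> As ! j" using that len As by (simp add: nth_eq_iff_index_eq)
    then show ?thesis
      using mem that P unfolding subpart_def pairwise_def disjnt_def by blast
  qed
  moreover have "As ! i \<noteq> {} \<and> As ! i \<subseteq> V" if "i < m" for i
    using mem[OF that] P unfolding subpart_def by blast
  ultimately have "As \<in> subpartitions m V"
    using len unfolding subpartitions_def by blast
  then show thesis using that As Q by blast
qed

lemma unions_eq_part_unions: "unions As = part_unions (set As)"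
proof
  show "unions As \<subseteq> part_unions (set As)"
  proof
    fix S assume "S \<in> unions As"
    then obtain I where I: "S = (\<Union>i\<in>I. As ! i)" "I \<noteq> {}" "I \<subseteq> {..<length As}"
      unfolding unions_def by blast
    then have "(!) As ` I \<subseteq> set As" "(!) As ` I \<noteq> {}" by auto
    then show "S \<in> part_unions (set As)" using I(1) unfolding part_unions_def by blast
  qed
  show "part_unions (set As) \<subseteq> unions As"
  proof
    fix S assume "S \<in> part_unions (set As)"
    then obtain C where C: "S = \<Union>C" "C \<subseteq> set As" "C \<noteq> {}"
      unfolding part_unions_def by blast
    have "set As = (!) As ` {..<length As}"
      by (auto simp: in_set_conv_nth)
    then obtain I where "I \<subseteq> {..<length As}" "C = (!) As ` I"
      using C(2) by (metis subset_image_iff)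
    then show "S \<in> unions As" using C unfolding unions_def by blast
  qed
qed

section \<open>Two large subpartitions have a common union\<close>

text \<open>Read \<open>X\<close> as the nodes of a graph whose edges \<open>v \<in> V\<close> join \<open>f v\<close> to \<open>g v\<close>. With fewer than
  \<open>card X - 1\<close> edges the graph is disconnected, so some component \<open>C\<close> misses the root \<open>r\<close>. The
  induction contracts one edge at a time.\<close>

lemma closed_set_avoiding_root:
  fixes f g :: "'v \<Rightarrow> 'x"
  assumes "finite V" "finite X" "r \<in> X" "card X > card V + 1"
    and "\<And>v. v \<in> V \<Longrightarrow> f v \<in> X \<and> g v \<in> X"
  shows "\<exists>C. C \<noteq> {} \<and> C \<subseteq> X - {r} \<and> (\<forall>v \<in> V. f v \<in> C \<longleftrightarrow> g v \<in> C)"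
  using assms
proof (induction V arbitrary: X f g rule: finite_induct)
  case empty
  have "X - {r} \<noteq> {}"
  proof
    assume "X - {r} = {}"
    then have "X = {r}" using empty by blast
    then show False using empty by simp
  qed
  then show ?case by blast
next
  case (insert v V)
  show ?case
  proof (cases "f v = g v")
    case True
    have "card X > card V + 1" using insert by simp
    then obtain C where "C \<noteq> {}" "C \<subseteq> X - {r}" "\<forall>v \<in> V. f v \<in> C \<longleftrightarrow> g v \<in> C"
      using insert.IH[of X f g] insert.prems by blast
    then show ?thesis using True by (intro exI[of _ C]) simp
  next
    case False
    \<comment> \<open>Contract the edge \<open>v\<close>: its end \<open>a\<close>, chosen different from the root, is merged into \<open>b\<close>.\<close>
    obtain a b where ab: "{a, b} = {f v, g v}" "a \<noteq> r" "a \<noteq> b"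
    proof (cases "f v = r")
      case True
      then show thesis using that[of "g v" "f v"] False by auto
    next
      case f: False
      then show thesis using that[of "f v" "g v"] False by auto
    qed
    have abX: "a \<in> X" "b \<in> X" using ab insert.prems(4)[of v] by (auto simp: doubleton_eq_iff)
    define h where "h = (\<lambda>x. if x = a then b else x)"
    have hX: "h x \<in> X - {a}" if "x \<in> X" for x using that abX ab by (auto simp: h_def)
    have "card (X - {a}) > card V + 1"
      using insert.hyps insert.prems abX by simp
    moreover have "(h \<circ> f) x \<in> X - {a} \<and> (h \<circ> g) x \<in> X - {a}" if "x \<in> V" for x
      using insert.prems(4)[of x] that hX by simp
    ultimately obtain C where C: "C \<noteq> {}" "C \<subseteq> X - {a} - {r}"
        "\<forall>x \<in> V. (h \<circ> f) x \<in> C \<longleftrightarrow> (h \<circ> g) x \<in> C"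
      using insert.IH[of "X - {a}" "h \<circ> f" "h \<circ> g"] insert.prems(1,2) ab(2) by blast
    let ?D = "{x \<in> X. h x \<in> C}"
    have "C \<subseteq> ?D" using C by (auto simp: h_def)
    moreover have "r \<notin> ?D" using C ab by (auto simp: h_def)
    moreover have "f x \<in> ?D \<longleftrightarrow> g x \<in> ?D" if "x \<in> insert v V" for x
    proof (cases "x = v")
      case True
      have "h (f v) = h (g v)" using ab by (auto simp: h_def doubleton_eq_iff)
      then show ?thesis using True insert.prems(4)[of v] by simp
    next
      case False
      then show ?thesis using C(3) that insert.prems(4)[of x] by auto
    qed
    ultimately show ?thesis using C(1) by (intro exI[of _ ?D] conjI ballI) blast+
  qed
qed

definition part_of :: "'a set set \<Rightarrow> 'a \<Rightarrow> 'a set option" where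
  "part_of P v = (if \<exists>A \<in> P. v \<in> A then Some (THE A. A \<in> P \<and> v \<in> A) else None)"

lemma part_of_eq_Some_iff:
  assumes "subpart V P"
  shows "part_of P v = Some A \<longleftrightarrow> A \<in> P \<and> v \<in> A"
proof -
  have "(THE B. B \<in> P \<and> v \<in> B) = B" if "B \<in> P" "v \<in> B" for B
    using that subpart_unique[OF assms] by (intro the_equality) auto
  then show ?thesis unfolding part_of_def by auto
qed

text \<open>Take the parts of \<open>P\<close> and of \<open>Q\<close> as the nodes of a graph, together with one root \<open>None\<close> that
  stands for the uncovered vertices on both sides. Each vertex of \<open>V\<close> is an edge that joins its
  part in \<open>P\<close> to its part in \<open>Q\<close>. In a union of components that avoids the root, the parts from
  \<open>P\<close> and those from \<open>Q\<close> cover the same vertices.\<close>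

lemma common_union:
  assumes V: "finite V" and P: "subpart V P" and Q: "subpart V Q"
    and big: "card P + card Q > card V"
  shows "part_unions P \<inter> part_unions Q \<noteq> {}"
proof -
  define X where "X = insert None (Some ` (P <+> Q))"
  define f :: "'a \<Rightarrow> ('a set + 'a set) option" where "f v = map_option Inl (part_of P v)" for v
  define g :: "'a \<Rightarrow> ('a set + 'a set) option" where "g v = map_option Inr (part_of Q v)" for v
  have fin: "finite P" "finite Q" using V P Q subpart_finite by auto
  have "card (Some ` (P <+> Q)) = card P + card Q"
    using fin by (simp add: card_image card_Plus)
  then have "card X > card V + 1"
    using big fin by (simp add: X_def card_insert_if image_iff)
  moreover have "f v \<in> X" for v
    using part_of_eq_Some_iff[OF P] by (cases "part_of P v") (auto simp: X_def f_def)
  moreover have "g v \<in> X" for v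
    using part_of_eq_Some_iff[OF Q] by (cases "part_of Q v") (auto simp: X_def g_def)
  moreover have "finite X" "None \<in> X" using fin unfolding X_def by auto
  ultimately obtain C where C: "C \<noteq> {}" "C \<subseteq> X - {None}" "\<forall>v \<in> V. f v \<in> C \<longleftrightarrow> g v \<in> C"
    using closed_set_avoiding_root[OF V, of X None f g] by (metis (no_types, lifting))
  define PC where "PC = {A \<in> P. Some (Inl A) \<in> C}"
  define QC where "QC = {B \<in> Q. Some (Inr B) \<in> C}"
  have None: "None \<notin> C" using C by blast
  have f_iff: "f v \<in> C \<longleftrightarrow> v \<in> \<Union>PC" for v
  proof -
    have "f v \<in> C \<longleftrightarrow> (\<exists>A. part_of P v = Some A \<and> Some (Inl A) \<in> C)"
      using None by (cases "part_of P v") (simp_all add: f_def)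
    then show ?thesis unfolding part_of_eq_Some_iff[OF P] PC_def by blast
  qed
  have g_iff: "g v \<in> C \<longleftrightarrow> v \<in> \<Union>QC" for v
  proof -
    have "g v \<in> C \<longleftrightarrow> (\<exists>A. part_of Q v = Some A \<and> Some (Inr A) \<in> C)"
      using None by (cases "part_of Q v") (simp_all add: g_def)
    then show ?thesis unfolding part_of_eq_Some_iff[OF Q] QC_def by blast
  qed
  have "\<Union>PC \<subseteq> V" "\<Union>QC \<subseteq> V"
    using P Q unfolding subpart_def PC_def QC_def by auto
  then have eq: "\<Union>PC = \<Union>QC"
    using C(3) unfolding f_iff g_iff by blast
  obtain x where x: "x \<in> C" "x \<in> Some ` (P <+> Q)" using C(1,2) unfolding X_def by blast
  \<comment> \<open>Parts are nonempty, so if one side contributes a part, the other has to contribute one too.\<close>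
  then have "PC \<noteq> {} \<or> QC \<noteq> {}" unfolding PC_def QC_def by auto
  moreover have "{} \<notin> PC" "{} \<notin> QC"
    using P Q unfolding PC_def QC_def subpart_def by auto
  ultimately have "PC \<noteq> {} \<and> QC \<noteq> {}"
    using eq by (metis Union_empty Union_empty_conv all_not_in_conv)
  then have "\<Union>PC \<in> part_unions P" "\<Union>QC \<in> part_unions Q"
    unfolding part_unions_def PC_def QC_def by blast+
  then show ?thesis using eq by auto
qed

section \<open>Leaves of forests\<close>

definition simple_edges :: "'a set \<Rightarrow> 'a set set \<Rightarrow> bool" where
  "simple_edges V E \<longleftrightarrow> (\<forall>e \<in> E. \<exists>x y. e = {x, y} \<and> x \<in> V \<and> y \<in> V \<and> x \<noteq> y)"

lemma simple_edges_restrict: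
  assumes "simple_edges V E" "F \<subseteq> E" "\<forall>e \<in> F. u \<notin> e"
  shows "simple_edges (V - {u}) F"
  unfolding simple_edges_def
proof
  fix e assume e: "e \<in> F"
  then obtain x y where "e = {x, y}" "x \<in> V" "y \<in> V" "x \<noteq> y"
    using assms(1,2) unfolding simple_edges_def by (metis subsetD)
  moreover from this have "x \<noteq> u" "y \<noteq> u" using assms(3) e by auto
  ultimately show "\<exists>x y. e = {x, y} \<and> x \<in> V - {u} \<and> y \<in> V - {u} \<and> x \<noteq> y" by blast
qed

definition is_path :: "'a set set \<Rightarrow> 'a list \<Rightarrow> bool" where
  "is_path E vs \<longleftrightarrow> distinct vs \<and> (\<forall>i. Suc i < length vs \<longrightarrow> {vs ! i, vs ! Suc i} \<in> E)"

lemma is_path_Cons: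
  assumes "is_path E vs" "vs \<noteq> []" "x \<notin> set vs" "{x, hd vs} \<in> E"
  shows "is_path E (x # vs)"
proof -
  have "{(x # vs) ! i, (x # vs) ! Suc i} \<in> E" if "Suc i < length (x # vs)" for i
    using assms that unfolding is_path_def by (cases i) (auto simp: hd_conv_nth)
  then show ?thesis using assms unfolding is_path_def by simp
qed

lemma path_chord_cycle:
  assumes "is_path E vs" "2 \<le> j" "j < length vs" "{vs ! j, vs ! 0} \<in> E"
  shows "is_cycle E (take (Suc j) vs)"
proof -
  have "{vs ! i, vs ! (Suc i mod Suc j)} \<in> E" if "i < Suc j" for i
  proof (cases "i = j")
    case False
    then have "Suc i < Suc j" using that by simp
    then show ?thesis using assms unfolding is_path_def by auto
  qed (use assms in simp)
  then show ?thesis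
    using assms unfolding is_cycle_def is_path_def by auto
qed

text \<open>The first vertex of a longest path has at most one neighbour: a neighbour off the path would
  extend the path, and one beyond the second position would close a cycle.\<close>

lemma forest_leaf:
  assumes V: "finite V" "V \<noteq> {}" and E: "simple_edges V E"
    and acyclic: "\<And>vs. \<not> is_cycle E vs"
  obtains u where "u \<in> V" "\<forall>e \<in> E. u \<notin> e"
    | u p where "u \<in> V" "p \<in> V" "u \<noteq> p" "{u, p} \<in> E" "\<forall>e \<in> E. u \<in> e \<longrightarrow> e = {u, p}"
proof -
  define paths where "paths = {vs. is_path E vs \<and> vs \<noteq> [] \<and> set vs \<subseteq> V}"
  obtain v where "v \<in> V" using V by blast
  then have ne: "[v] \<in> paths" by (simp add: paths_def is_path_def)
  have "length vs \<le> card V" if "vs \<in> paths" for vs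
    using that card_mono[OF V(1), of "set vs"] distinct_card[of vs]
    unfolding paths_def is_path_def by simp
  then obtain vs where vs: "vs \<in> paths" and max: "\<And>us. us \<in> paths \<Longrightarrow> length us \<le> length vs"
    using ex_has_greatest_nat[of "\<lambda>vs. vs \<in> paths", OF ne, of length "Suc (card V)"]
      le_imp_less_Suc by blast
  define u where "u = vs ! 0"
  have path: "is_path E vs" "vs \<noteq> []" "set vs \<subseteq> V" using vs by (auto simp: paths_def)
  have u: "u \<in> V" "hd vs = u" using path by (auto simp: u_def hd_conv_nth)
  have nbr: "\<exists>x \<in> V. x \<noteq> u \<and> e = {x, u}" if "e \<in> E" "u \<in> e" for e
    using that E unfolding simple_edges_def by fastforce
  have second: "length vs > 1 \<and> x = vs ! 1" if x: "x \<in> V" "x \<noteq> u" "{x, u} \<in> E" for x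
  proof -
    have "x \<in> set vs"
    proof (rule ccontr)
      assume "x \<notin> set vs"
      then have "x # vs \<in> paths"
        using is_path_Cons[of E vs x] path x u by (auto simp: paths_def)
      then show False using max by fastforce
    qed
    then obtain j where j: "j < length vs" "x = vs ! j" by (metis in_set_conv_nth)
    have "j \<noteq> 0" using j x unfolding u_def by metis
    moreover have "\<not> 2 \<le> j"
      using path_chord_cycle[OF path(1) _ j(1)] acyclic j x by (auto simp: u_def)
    ultimately have "j = 1" by linarith
    then show ?thesis using j by simp
  qed
  show thesis
  proof (cases "\<exists>e \<in> E. u \<in> e")
    case False
    then show thesis using that(1) u by blast
  next
    case True
    then obtain p where p: "p \<in> V" "p \<noteq> u" "{p, u} \<in> E" using nbr by metis
    have "\<forall>e \<in> E. u \<in> e \<longrightarrow> e = {u, p}"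
      using nbr second p by blast
    moreover have "{u, p} \<in> E" using p(3) by (subst insert_commute)
    ultimately show thesis using that(2)[of u p] u(1) p(1,2) by blast
  qed
qed

section \<open>Inertia of a weighted forest\<close>

text \<open>For \<open>c = (\<lambda>v. - L * \<mu> v)\<close> the sign of the energy of \<open>S\<close> compares \<open>phi E \<mu> w S\<close> with \<open>L\<close>. Leaf
  removal leads to weights \<open>c\<close> of arbitrary sign.\<close>

definition energy :: "'a set set \<Rightarrow> ('a set \<Rightarrow> real) \<Rightarrow> ('a \<Rightarrow> real) \<Rightarrow> 'a set \<Rightarrow> real" where
  "energy E w c S = (\<Sum>e \<in> edge_boundary E S. w e) + (\<Sum>v \<in> S. c v)"

lemma energy_empty [simp]: "energy E w c {} = 0"
  by (simp add: energy_def edge_boundary_def)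

lemma edge_boundary_insert_isolated:
  assumes "\<forall>e \<in> E. u \<notin> e"
  shows "edge_boundary E (insert u S) = edge_boundary E S"
  using assms unfolding edge_boundary_def by blast

lemma energy_insert_isolated:
  assumes "\<forall>e \<in> E. u \<notin> e" "finite S" "u \<notin> S"
  shows "energy E w c (insert u S) = energy E w c S + c u"
  using assms by (simp add: energy_def edge_boundary_insert_isolated)

lemma edge_boundary_insert_edge:
  "edge_boundary (insert {u, p} E) S =
     (if u \<in> S \<longleftrightarrow> p \<in> S then edge_boundary E S else insert {u, p} (edge_boundary E S))"
  unfolding edge_boundary_def by (auto simp: doubleton_eq_iff)

lemma energy_insert_edge:
  assumes "{u, p} \<notin> E" "finite E"
  shows "energy (insert {u, p} E) w c S =
    energy E w c S + (if u \<in> S \<longleftrightarrow> p \<in> S then 0 else w {u, p})"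
proof -
  have "edge_boundary E S \<subseteq> E" unfolding edge_boundary_def by blast
  then have "finite (edge_boundary E S)" "{u, p} \<notin> edge_boundary E S"
    using assms finite_subset by auto
  then show ?thesis by (simp add: energy_def edge_boundary_insert_edge)
qed

lemma energy_upd:
  assumes "finite S"
  shows "energy E w (c(p := c p + d)) S = energy E w c S + (if p \<in> S then d else 0)"
proof -
  have "(\<Sum>v \<in> S. (c(p := c p + d)) v) = (\<Sum>v \<in> S. c v + (if v = p then d else 0))"
    by (rule sum.cong) auto
  also have "\<dots> = (\<Sum>v \<in> S. c v) + (if p \<in> S then d else 0)"
    using assms by (simp add: sum.distrib)
  finally show ?thesis by (simp add: energy_def)
qed

text \<open>The energy of \<open>S\<close> is the value at the indicator function of \<open>S\<close> of the quadratic form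
  \<open>f \<mapsto> \<Sum> w\<^sub>x\<^sub>y (f x - f y)\<^sup>2 + \<Sum> c\<^sub>x (f x)\<^sup>2\<close>. The parts of \<open>P\<close> and of \<open>Q\<close> play the roles of bases of
  complementary subspaces on which the form is negative and nonnegative.\<close>

definition has_inertia_split ::
  "'a set \<Rightarrow> 'a set set \<Rightarrow> ('a set \<Rightarrow> real) \<Rightarrow> ('a \<Rightarrow> real) \<Rightarrow> bool" where
  "has_inertia_split V E w c \<longleftrightarrow> (\<exists>P Q. subpart V P \<and> subpart V Q \<and> card P + card Q = card V \<and>
    (\<forall>S \<in> part_unions P. energy E w c S < 0) \<and> (\<forall>S \<in> part_unions Q. energy E w c S \<ge> 0))"

lemma inertia_split_isolated:
  assumes V: "finite V" "u \<notin> V" and E: "\<forall>e \<in> E. u \<notin> e"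
    and split: "has_inertia_split V E w c"
  shows "has_inertia_split (insert u V) E w c"
proof -
  obtain P Q where P: "subpart V P" "\<And>S. S \<in> part_unions P \<Longrightarrow> energy E w c S < 0"
    and Q: "subpart V Q" "\<And>S. S \<in> part_unions Q \<Longrightarrow> energy E w c S \<ge> 0"
    and card: "card P + card Q = card V"
    using split unfolding has_inertia_split_def by auto
  have new: "energy E w c (insert u S) = energy E w c S + c u" if "S \<subseteq> V" for S
    using that finite_subset[OF that V(1)] V(2) by (intro energy_insert_isolated[OF E]) auto
  note mono = subpart_mono[OF P(1) subset_insertI] subpart_mono[OF Q(1) subset_insertI]
  note ext = subpart_insert_singleton[OF P(1) V(2)] subpart_insert_singleton[OF Q(1) V(2)]
  note fin = subpart_finite[OF V(1) P(1)] subpart_finite[OF V(1) Q(1)]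
  show ?thesis
  proof (cases "c u < 0")
    case True
    have "energy E w c S < 0" if "S \<in> part_unions (insert {u} P)" for S
      using that
    proof (cases rule: part_unions_insert_singletonE)
      case (2 S')
      then have "S' \<subseteq> V" "energy E w c S' \<le> 0"
        using P(2)[of S'] part_unions_subset[OF P(1), of S'] by auto
      then show ?thesis using True new[of S'] 2(1) by simp
    qed (use P in auto)
    moreover have "card (insert {u} P) + card Q = card (insert u V)"
      using ext fin card V by simp
    ultimately show ?thesis unfolding has_inertia_split_def using ext(1) mono(2) Q(2) by blast
  next
    case False
    have "energy E w c S \<ge> 0" if "S \<in> part_unions (insert {u} Q)" for S
      using that
    proof (cases rule: part_unions_insert_singletonE)
      case (2 S')
      then have "S' \<subseteq> V" "energy E w c S' \<ge> 0"
        using Q(2)[of S'] part_unions_subset[OF Q(1), of S'] by auto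
      then show ?thesis using False new[of S'] 2(1) by simp
    qed (use Q in auto)
    moreover have "card P + card (insert {u} Q) = card (insert u V)"
      using ext fin card V by simp
    ultimately show ?thesis unfolding has_inertia_split_def using ext(3) mono(1) P(2) by blast
  qed
qed

text \<open>Let \<open>W\<close> be the weight of the edge from the leaf \<open>u\<close> to \<open>p\<close>. A set \<open>S\<close> of old vertices containing
  \<open>p\<close> gains \<open>W\<close> from the new edge if \<open>u\<close> stays outside, and gains \<open>c u\<close> if \<open>u\<close> joins; a set without
  \<open>p\<close> gains \<open>0\<close> or \<open>c u + W\<close>.

  If \<open>c u\<close> is outside \<open>[-W, W)\<close>, the weight at \<open>p\<close> is raised by \<open>W\<close>, so that old sets keep their energy,
  and \<open>{u}\<close> becomes a part on the side given by the sign of \<open>c u\<close>: joining \<open>u\<close> changes the energy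
  by \<open>c u - W\<close> or \<open>c u + W\<close>, which are both negative or both nonnegative.

  If \<open>-W \<le> c u < W\<close>, the weight at \<open>p\<close> is raised by \<open>c u\<close>, the smaller of the two gains. Then \<open>{u}\<close> can be
  a part on the nonnegative side, because no set gains less than in the smaller forest; and on
  the negative side \<open>u\<close> follows \<open>p\<close>, which preserves every energy.\<close>

lemma inertia_split_leaf:
  fixes w :: "'a set \<Rightarrow> real" and c :: "'a \<Rightarrow> real" and u p :: 'a
  defines "d \<equiv> if - w {u, p} \<le> c u \<and> c u < w {u, p} then c u else w {u, p}"
  assumes V: "finite V" "u \<notin> V" "p \<in> V"
    and F: "finite F" "\<forall>e \<in> F. u \<notin> e" and wpos: "w {u, p} > 0"
    and split: "has_inertia_split V F w (c(p := c p + d))"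
  shows "has_inertia_split (insert u V) (insert {u, p} F) w c"
proof -
  let ?E = "insert {u, p} F" and ?c = "c(p := c p + d)" and ?w = "w {u, p}"
  obtain P Q where P: "subpart V P" "\<And>S. S \<in> part_unions P \<Longrightarrow> energy F w ?c S < 0"
    and Q: "subpart V Q" "\<And>S. S \<in> part_unions Q \<Longrightarrow> energy F w ?c S \<ge> 0"
    and card: "card P + card Q = card V"
    using split unfolding has_inertia_split_def by auto
  have edge: "{u, p} \<notin> F" and up: "u \<noteq> p" using F(2) V by auto
  have without_u: "energy ?E w c S = energy F w ?c S + (if p \<in> S then ?w - d else 0)"
    if "S \<subseteq> V" for S
  proof -
    have "finite S" "u \<notin> S" using that V finite_subset by auto
    then show ?thesis
      unfolding energy_insert_edge[OF edge F(1)] energy_upd[OF \<open>finite S\<close>] by simp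
  qed
  have with_u: "energy ?E w c (insert u S) =
      energy F w ?c S + c u + (if p \<in> S then - d else ?w)" if "S \<subseteq> V" for S
  proof -
    have S: "finite S" "u \<notin> S" using that V finite_subset by auto
    show ?thesis
      unfolding energy_insert_edge[OF edge F(1)] energy_upd[OF S(1)]
        energy_insert_isolated[OF F(2) S] using up by simp
  qed
  note mono = subpart_mono[OF P(1) subset_insertI] subpart_mono[OF Q(1) subset_insertI]
  note ext = subpart_insert_singleton[OF P(1) V(2)] subpart_insert_singleton[OF Q(1) V(2)]
  note fin = subpart_finite[OF V(1) P(1)] subpart_finite[OF V(1) Q(1)]
  have Qcard: "card P + card (insert {u} Q) = card (insert u V)"
    using ext fin card V by simp
  have Qnew: "energy ?E w c S \<ge> 0"
    if S: "S \<in> part_unions (insert {u} Q)" and cu: "c u \<ge> - ?w" for S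
    using S
  proof (cases rule: part_unions_insert_singletonE)
    case 1
    have "d \<le> ?w" by (simp add: d_def)
    then show ?thesis
      using without_u[OF part_unions_subset[OF Q(1) 1]] Q(2)[OF 1] by simp
  next
    case (2 S')
    then have S': "S' \<subseteq> V" "energy F w ?c S' \<ge> 0"
      using Q(2)[of S'] part_unions_subset[OF Q(1), of S'] by auto
    have "d \<le> c u" using cu by (auto simp: d_def)
    then show ?thesis using with_u[OF S'(1)] S'(2) cu 2(1) by simp
  qed
  consider "c u < - ?w" | "c u \<ge> ?w" | "- ?w \<le> c u" "c u < ?w" by linarith
  then show ?thesis
  proof cases
    case 1
    then have d: "d = ?w" by (simp add: d_def)
    have "energy ?E w c S < 0" if S: "S \<in> part_unions (insert {u} P)" for S
      using S
    proof (cases rule: part_unions_insert_singletonE)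
      case 1
      then show ?thesis using P(2)[OF 1] without_u[OF part_unions_subset[OF P(1) 1]] d by simp
    next
      case (2 S')
      then have S': "S' \<subseteq> V" "energy F w ?c S' \<le> 0"
        using P(2)[of S'] part_unions_subset[OF P(1), of S'] by auto
      have "c u + (if p \<in> S' then - d else ?w) < 0" using \<open>c u < - ?w\<close> d wpos by simp
      then show ?thesis using with_u[OF S'(1)] S'(2) unfolding 2(1) by linarith
    qed
    moreover have "energy ?E w c S \<ge> 0" if "S \<in> part_unions Q" for S
      using Q(2)[OF that] without_u[OF part_unions_subset[OF Q(1) that]] d by simp
    moreover have "card (insert {u} P) + card Q = card (insert u V)"
      using ext fin card V by simp
    ultimately show ?thesis unfolding has_inertia_split_def using ext(1) mono(2) by blast
  next
    case 2
    then have d: "d = ?w" by (simp add: d_def)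
    have "energy ?E w c S < 0" if "S \<in> part_unions P" for S
      using P(2)[OF that] without_u[OF part_unions_subset[OF P(1) that]] d by simp
    moreover have "c u \<ge> - ?w" using 2 wpos by linarith
    ultimately show ?thesis
      unfolding has_inertia_split_def using ext(3) mono(1) Qcard Qnew by blast
  next
    case 3
    then have d: "d = c u" by (simp add: d_def)
    let ?h = "\<lambda>X. if p \<in> X then insert u X else X"
    have "energy ?E w c S < 0" if S: "S \<in> part_unions (?h ` P)" for S
    proof -
      obtain T where T: "T \<in> part_unions P" "S = ?h T"
        using subpart_attach(3)[OF P(1) V(2) S] by blast
      then show ?thesis
        using P(2)[OF T(1)] without_u[OF part_unions_subset[OF P(1) T(1)]]
          with_u[OF part_unions_subset[OF P(1) T(1)]] d by (cases "p \<in> T") auto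
    qed
    moreover have "card (?h ` P) + card (insert {u} Q) = card (insert u V)"
      using subpart_attach(2)[OF P(1) V(2), of p] Qcard by simp
    moreover have "subpart (insert u V) (?h ` P)"
      using subpart_attach(1)[OF P(1) V(2), of p] .
    ultimately show ?thesis
      unfolding has_inertia_split_def using ext(3) Qnew 3(1) by blast
  qed
qed

lemma forest_has_inertia_split:
  assumes "finite V" "simple_edges V E"
    and "\<And>vs. \<not> is_cycle E vs" "\<And>e. e \<in> E \<Longrightarrow> w e > 0"
  shows "has_inertia_split V E w c"
  using assms
proof (induction "card V" arbitrary: V E c)
  case 0
  then have "V = {}" by simp
  then show ?case
    unfolding has_inertia_split_def
    by (intro exI[of _ "{}"]) (simp add: subpart_def part_unions_def)
next
  case (Suc m V E c)
  have "V \<noteq> {}" using Suc.hyps(2) by auto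
  from Suc.prems(1) this Suc.prems(2,3) show ?case
  proof (cases rule: forest_leaf)
    case (1 u)
    have "m = card (V - {u})" "finite (V - {u})" using Suc.hyps(2) Suc.prems(1) 1(1) by auto
    moreover have "simple_edges (V - {u}) E"
      using simple_edges_restrict[OF Suc.prems(2) subset_refl 1(2)] .
    ultimately have "has_inertia_split (V - {u}) E w c"
      using Suc.hyps(1) Suc.prems(3,4) by blast
    then have "has_inertia_split (insert u (V - {u})) E w c"
      using inertia_split_isolated[OF _ _ 1(2)] Suc.prems(1) by blast
    then show ?thesis using 1(1) by (simp add: insert_absorb)
  next
    case (2 u p)
    let ?F = "E - {{u, p}}"
    have F: "\<forall>e \<in> ?F. u \<notin> e" using 2(5) by blast
    have "E \<subseteq> Pow V" using Suc.prems(2) unfolding simple_edges_def by fastforce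
    then have "finite ?F" using Suc.prems(1) by (meson finite_Diff finite_Pow_iff finite_subset)
    moreover have V: "m = card (V - {u})" "finite (V - {u})"
      using Suc.hyps(2) Suc.prems(1) 2(1) by auto
    moreover have "simple_edges (V - {u}) ?F"
      using simple_edges_restrict[OF Suc.prems(2) Diff_subset F] .
    moreover have "\<not> is_cycle ?F vs" for vs
      using Suc.prems(3)[of vs] unfolding is_cycle_def by blast
    then have "has_inertia_split (V - {u}) ?F w c'" for c'
      using Suc.hyps(1)[OF V \<open>simple_edges (V - {u}) ?F\<close>] Suc.prems(4) by blast
    ultimately have "has_inertia_split (insert u (V - {u})) (insert {u, p} ?F) w c"
      using 2 F Suc.prems(4) by (intro inertia_split_leaf) blast+
    then show ?thesis using 2(1,4) by (simp add: insert_absorb)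
  qed
qed

section \<open>The minimax identity\<close>

theorem theorem1:
  fixes n k :: nat
    and E :: "nat set set"
    and \<mu> :: "nat \<Rightarrow> real"
    and w :: "nat set \<Rightarrow> real"
  assumes "weighted_forest n E \<mu> w"
    and "k \<in> {1..n}"
  shows "(MIN As \<in> subpartitions k {1..n}. MAX B \<in> unions As. phi E \<mu> w B) =
         (MAX As \<in> subpartitions (n - k + 1) {1..n}. MIN B \<in> unions As. phi E \<mu> w B)"
proof -
  interpret weighted_forest n E \<mu> w by fact
  let ?V = "{1..n}" and ?l = "n - k + 1"
  have k: "1 \<le> k" "k \<le> n" using assms(2) by auto
  define top where "top As = (MAX B \<in> unions As. phi E \<mu> w B)" for As
  define bot where "bot As = (MIN B \<in> unions As. phi E \<mu> w B)" for As
  have fin: "finite (top ` subpartitions k ?V)" "finite (bot ` subpartitions ?l ?V)"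
    using finite_subpartitions[of ?V] by auto
  have ne: "subpartitions k ?V \<noteq> {}" "subpartitions ?l ?V \<noteq> {}"
    using k by (intro subpartitions_nonempty; simp)+
  have un: "finite (phi E \<mu> w ` unions As)" "unions As \<noteq> {}"
    if "As \<in> subpartitions m ?V" "m \<ge> 1" for As m
    using that finite_unions[of As] unions_nonempty[of As] unfolding subpartitions_def by auto
  have phi_top: "phi E \<mu> w B \<le> top As"
    if "As \<in> subpartitions k ?V" "B \<in> unions As" for As B
    unfolding top_def using un[OF that(1) k(1)] that(2) by (intro Max_ge) auto
  have phi_bot: "bot As \<le> phi E \<mu> w B"
    if "As \<in> subpartitions ?l ?V" "B \<in> unions As" for As B
    unfolding bot_def using un[OF that(1)] that(2) by (intro Min_le) auto
  have weak: "bot Bs \<le> top As"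
    if A: "As \<in> subpartitions k ?V" and B: "Bs \<in> subpartitions ?l ?V" for As Bs
  proof -
    have "card (set As) + card (set Bs) > card ?V"
      using subpartitions_imp_subpart(2)[OF A] subpartitions_imp_subpart(2)[OF B] k by simp
    then obtain S where "S \<in> unions As" "S \<in> unions Bs"
      using common_union[of ?V "set As" "set Bs"] subpartitions_imp_subpart(1)[OF A]
        subpartitions_imp_subpart(1)[OF B] unfolding unions_eq_part_unions by auto
    then show ?thesis using phi_top[OF A] phi_bot[OF B] by (meson order_trans)
  qed
  define L where "L = Min (top ` subpartitions k ?V)"
  define R where "R = Max (bot ` subpartitions ?l ?V)"
  have "R \<le> L"
    using weak fin ne unfolding L_def R_def by (auto simp: Max_le_iff Min_ge_iff)
  moreover have "L \<le> R"
  proof -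
    have "simple_edges ?V E" using edges unfolding simple_edges_def by blast
    then obtain P Q where P: "subpart ?V P"
        "\<And>S. S \<in> part_unions P \<Longrightarrow> energy E w (\<lambda>v. - L * \<mu> v) S < 0"
      and Q: "subpart ?V Q"
        "\<And>S. S \<in> part_unions Q \<Longrightarrow> energy E w (\<lambda>v. - L * \<mu> v) S \<ge> 0"
      and card: "card P + card Q = n"
      using forest_has_inertia_split[of ?V E w "\<lambda>v. - L * \<mu> v"] no_cycle edge_weight_pos
      unfolding has_inertia_split_def by auto
    have pos: "(\<Sum>v \<in> S. \<mu> v) > 0" if "S \<subseteq> ?V" "S \<noteq> {}" for S
      using that finite_subset[OF that(1)] vertex_weight_pos by (intro sum_pos) auto
    have energy_eq: "energy E w (\<lambda>v. - L * \<mu> v) S =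
        (\<Sum>e \<in> edge_boundary E S. w e) - L * (\<Sum>v \<in> S. \<mu> v)" for S
      by (simp add: energy_def sum_negf flip: sum_distrib_left)
    have phiP: "phi E \<mu> w S < L" if "S \<in> part_unions P" for S
      using P(2)[OF that] pos[of S] part_unions_subset[OF P(1) that]
        part_unions_not_empty[OF P(1) that]
      unfolding energy_eq phi_def by (simp add: divide_less_eq)
    have phiQ: "L \<le> phi E \<mu> w S" if "S \<in> part_unions Q" for S
      using Q(2)[OF that] pos[of S] part_unions_subset[OF Q(1) that]
        part_unions_not_empty[OF Q(1) that]
      unfolding energy_eq phi_def by (simp add: le_divide_eq)
    \<comment> \<open>Otherwise \<open>k\<close> parts of \<open>P\<close> would stay below the minimum \<open>L\<close>.\<close>
    have "card P < k"
    proof (rule ccontr)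
      assume "\<not> card P < k"
      then obtain As where As: "As \<in> subpartitions k ?V" "set As \<subseteq> P"
        using subpart_imp_subpartitions[OF P(1), of k] by auto
      have "top As < L"
        unfolding top_def using un[OF As(1) k(1)] phiP part_unions_mono[OF As(2)]
        by (subst Max_less_iff) (auto simp: unions_eq_part_unions)
      moreover have "L \<le> top As" unfolding L_def using fin As by (intro Min_le) auto
      ultimately show False by simp
    qed
    then have l: "?l \<le> card Q" using card k by linarith
    obtain Bs where Bs: "Bs \<in> subpartitions ?l ?V" "set Bs \<subseteq> Q"
      using subpart_imp_subpartitions[OF Q(1) l] by auto
    have "L \<le> bot Bs"
      unfolding bot_def using un[OF Bs(1)] phiQ part_unions_mono[OF Bs(2)]
      by (subst Min_ge_iff) (auto simp: unions_eq_part_unions)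
    also have "\<dots> \<le> R" unfolding R_def using fin Bs by (intro Max_ge) auto
    finally show ?thesis .
  qed
  ultimately show ?thesis unfolding L_def R_def top_def bot_def by simp
qed

end
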